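(* Let $m$ and $b$ be integers with $3\le m\le b$, and let $G\cong(\mathbb{Z}/2)^3$. Then there is a trivalent graph $\Gamma$ with $b_1(\Gamma)=b$ and an unsplittable $G$-coloring of $\Gamma$ which has a special $m$-circuit.
   Context: $b_1$ is the first Betti number. A graph is a (compact) 1-dimensional polyhedron; a vertex is a point at which it is not a 1-manifold, and an edge is the closure of a component of the complement of the set of vertices. A circuit is a subgraph homeomorphic to a circle; an $m$-circuit is a circuit consisting of $m$ edges. For a subgraph $\Gamma'\subseteq\Gamma$, $\Gamma\setminus\Gamma'$ denotes the closure of the set-theoretic complement of $\Gamma'$ in $\Gamma$. $G$ is written multiplicatively. A $G$-coloring of a trivalent graph $\Gamma$ is an assignment of a color in $G\setminus\{1\}$ to each edge, such that the product of the colors of the three edges at each vertex is $1$ and the colors generate $G$. $\mathcal{C}^\star$ is the set of index-2 subgroups of $G$; for $H\in\mathcal{C}^\star$, $\Gamma_H$ is the union of the edges of $\Gamma$ whose colors are not in $H$. The coloring is unsplittable if, for every $g\in G$ (including $g=1$), deleting the edges of color $g$ from $\Gamma$ leaves a connected graph. A circuit $C$ in $\Gamma$ is special if there is some $H\in\mathcal{C}^\star$ such that $\Gamma_H=C$ and $\Gamma\setminus C$ is connected. *)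

theory Defs
  imports
    "HOL-Algebra.Algebra"
    "HOL-Library.Function_Algebras"
    "Graph_Theory.Graph_Theory"
begin

text \<open>
  A graph, as a compact 1-dimensional polyhedron whose vertices are its non-manifold points, is
  given by its finite cell structure: \<^const>\<open>arcs\<close> are the edges, each with an arbitrarily chosen
  orientation from \<^const>\<open>tail\<close> to \<^const>\<open>head\<close>. Loops and multiple edges are allowed. A component
  without a vertex, i.e. a circle, is not represented. A connected graph having such a component
  is a circle, with a single edge, hence with no coloring that generates a noncyclic group.
\<close>

text \<open>A loop at a vertex is both an in-arc and an out-arc there, so it is counted twice.\<close>

definition trivalent :: "('v, 'e) pre_digraph \<Rightarrow> bool" where
  "trivalent \<Gamma> \<longleftrightarrow> fin_digraph \<Gamma> \<and>
    (\<forall>v\<in>verts \<Gamma>. card (in_arcs \<Gamma> v) + card (out_arcs \<Gamma> v) = 3)"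

text \<open>
  The first Betti number is the dimension of the first cellular homology with rational
  coefficients. As there are no 2-cells, this homology is the kernel of the boundary map.
\<close>

interpretation chains: vector_space "\<lambda>(c::rat) (f::'e \<Rightarrow> rat) e. c * f e"
  by unfold_locales (auto simp: fun_eq_iff algebra_simps)

definition boundary :: "('v, 'e) pre_digraph \<Rightarrow> ('e \<Rightarrow> rat) \<Rightarrow> 'v \<Rightarrow> rat" where
  "boundary \<Gamma> f v = (\<Sum>e\<in>in_arcs \<Gamma> v. f e) - (\<Sum>e\<in>out_arcs \<Gamma> v. f e)"

definition first_betti :: "('v, 'e) pre_digraph \<Rightarrow> nat" where
  "first_betti \<Gamma> =
    chains.dim {f. (\<forall>e. e \<notin> arcs \<Gamma> \<longrightarrow> f e = 0) \<and> (\<forall>v\<in>verts \<Gamma>. boundary \<Gamma> f v = 0)}"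

text \<open>
  The union of a set of (closed) edges. If \<open>\<Gamma>'\<close> is the union of the edges in \<open>F\<close>, then the closure
  of the complement of \<open>\<Gamma>'\<close> is the union of the edges not in \<open>F\<close>; in particular it contains no
  isolated vertices.
\<close>

definition edge_union :: "('v, 'e) pre_digraph \<Rightarrow> 'e set \<Rightarrow> ('v, 'e) pre_digraph" where
  "edge_union \<Gamma> F = \<Gamma>\<lparr>verts := tail \<Gamma> ` F \<union> head \<Gamma> ` F, arcs := F\<rparr>"

text \<open>
  The library's \<^const>\<open>Digraph_Component.connected\<close> ignores orientations and excludes the empty
  graph.
\<close>

definition connected_edges :: "('v, 'e) pre_digraph \<Rightarrow> 'e set \<Rightarrow> bool" where
  "connected_edges \<Gamma> F \<longleftrightarrow> Digraph_Component.connected (edge_union \<Gamma> F)"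

text \<open>
  A subgraph homeomorphic to a circle, given by its set of edges: it is traversed by a cyclic
  sequence of distinct vertices and distinct edges, in which a loop (length 1) and a pair of
  parallel edges (length 2) are allowed.
\<close>

definition circuit :: "('v, 'e) pre_digraph \<Rightarrow> 'e set \<Rightarrow> bool" where
  "circuit \<Gamma> C \<longleftrightarrow> C \<subseteq> arcs \<Gamma> \<and>
    (\<exists>es vs. es \<noteq> [] \<and> length vs = length es \<and> distinct es \<and> distinct vs \<and> set es = C \<and>
      (\<forall>i<length es.
        {tail \<Gamma> (es ! i), head \<Gamma> (es ! i)} = {vs ! i, vs ! (Suc i mod length es)}))"

definition m_circuit :: "('v, 'e) pre_digraph \<Rightarrow> nat \<Rightarrow> 'e set \<Rightarrow> bool" where
  "m_circuit \<Gamma> m C \<longleftrightarrow> circuit \<Gamma> C \<and> card C = m"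

text \<open>The group is meant to be abelian, so that \<^const>\<open>finprod\<close> makes sense.\<close>

definition coloring ::
  "('g, 'x) monoid_scheme \<Rightarrow> ('v, 'e) pre_digraph \<Rightarrow> ('e \<Rightarrow> 'g) \<Rightarrow> bool" where
  "coloring G \<Gamma> c \<longleftrightarrow>
    (\<forall>e\<in>arcs \<Gamma>. c e \<in> carrier G - {\<one>\<^bsub>G\<^esub>}) \<and>
    (\<forall>v\<in>verts \<Gamma>. finprod G c (in_arcs \<Gamma> v) \<otimes>\<^bsub>G\<^esub> finprod G c (out_arcs \<Gamma> v) = \<one>\<^bsub>G\<^esub>) \<and>
    generate G (c ` arcs \<Gamma>) = carrier G"

definition unsplittable ::
  "('g, 'x) monoid_scheme \<Rightarrow> ('v, 'e) pre_digraph \<Rightarrow> ('e \<Rightarrow> 'g) \<Rightarrow> bool" where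
  "unsplittable G \<Gamma> c \<longleftrightarrow>
    (\<forall>g\<in>carrier G. connected_edges \<Gamma> {e \<in> arcs \<Gamma>. c e \<noteq> g})"

definition index2_subgroups :: "('g, 'x) monoid_scheme \<Rightarrow> 'g set set" where
  "index2_subgroups G = {H. subgroup H G \<and> card (rcosets\<^bsub>G\<^esub> H) = 2}"

definition edges_outside :: "('v, 'e) pre_digraph \<Rightarrow> ('e \<Rightarrow> 'g) \<Rightarrow> 'g set \<Rightarrow> 'e set" where
  "edges_outside \<Gamma> c H = {e \<in> arcs \<Gamma>. c e \<notin> H}"

definition special ::
  "('g, 'x) monoid_scheme \<Rightarrow> ('v, 'e) pre_digraph \<Rightarrow> ('e \<Rightarrow> 'g) \<Rightarrow> 'e set \<Rightarrow> bool" where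
  "special G \<Gamma> c C \<longleftrightarrow>
    (\<exists>H\<in>index2_subgroups G. edges_outside \<Gamma> c H = C \<and> connected_edges \<Gamma> (arcs \<Gamma> - C))"

end

theory Submission
  imports Defs
begin

text \<open>
  Fix a subgroup \<open>H\<close> of index 2. Starting from the tetrahedron, where \<open>m = b = 3\<close>, all pairs
  \<open>(m, b)\<close> are reached by truncating vertices, that is, by replacing a vertex with a triangle.

  A vertex whose edges have colors \<open>p\<close>, \<open>q\<close>, \<open>p q\<close> is truncated as follows: for some \<open>s\<close> other than
  these three colors, each triangle edge receives \<open>s\<close> times the color of the old edge that leaves
  the opposite corner. As \<open>G\<close> has exponent 2, the product of the colors at each corner of the
  triangle is again 1, and \<open>s\<close> was chosen such that no new color is 1. The first Betti number goes
  up by 1, with the boundary of the triangle as an additional independent cycle.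

  Unsplittability is inherited because the three colors on the triangle are distinct. Deleting a
  color thus deletes at most one side of the triangle and leaves its corners connected to each
  other, so that contracting what is left of the triangle to a point recovers the situation before
  the truncation (\<open>connected_truncated\<close>). The same argument applies to the complement of the special
  circuit \<open>C\<close>, whose edges are those with a color outside \<open>H\<close>. There are two cases:

  \<^item> At a vertex off \<open>C\<close> take \<open>s = 1\<close>. The new colors lie in \<open>H\<close>, hence \<open>C\<close> does not change. This
    increases \<open>b\<close> and keeps \<open>m\<close>.
  \<^item> At a vertex on \<open>C\<close>, where exactly one edge has its color in \<open>H\<close>, take \<open>s\<close> outside \<open>H\<close>. Of the
    three new edges only the one opposite to that edge has its color outside \<open>H\<close>, and \<open>C\<close> passes
    through it. This increases both \<open>b\<close> and \<open>m\<close>.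

  On the tetrahedron, \<open>C\<close> is a triangle and the star of the remaining vertex is colored by the
  three nontrivial elements of \<open>H\<close>. Then \<open>b - m\<close> truncations at that vertex and \<open>m - 3\<close>
  truncations on the circuit give the required graph.
\<close>

section \<open>Connectedness of a set of edges\<close>

text \<open>
  Reachability in the subgraph with edge set \<open>F\<close>. It is defined for all vertices, which avoids
  keeping track of the vertex set of that subgraph when \<open>F\<close> or the graph changes.
\<close>

definition linked :: "('v, 'e) pre_digraph \<Rightarrow> 'e set \<Rightarrow> 'v \<Rightarrow> 'v \<Rightarrow> bool" where
  "linked \<Gamma> F u w \<longleftrightarrow>
    (u, w) \<in> (\<Union>e\<in>F. {(tail \<Gamma> e, head \<Gamma> e), (head \<Gamma> e, tail \<Gamma> e)})\<^sup>*"

lemma linked_refl [simp]: "linked \<Gamma> F u u"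
  by (simp add: linked_def)

lemma linked_trans [trans]: "linked \<Gamma> F u v \<Longrightarrow> linked \<Gamma> F v w \<Longrightarrow> linked \<Gamma> F u w"
  by (simp add: linked_def)

lemma linked_sym:
  assumes "linked \<Gamma> F u w"
  shows "linked \<Gamma> F w u"
proof -
  have "sym (\<Union>e\<in>F. {(tail \<Gamma> e, head \<Gamma> e), (head \<Gamma> e, tail \<Gamma> e)})"
    by (auto simp: sym_def)
  with assms show ?thesis
    unfolding linked_def by (meson sym_rtrancl symD)
qed

lemma linked_edge:
  assumes "e \<in> F"
  shows "linked \<Gamma> F (tail \<Gamma> e) (head \<Gamma> e)" and "linked \<Gamma> F (head \<Gamma> e) (tail \<Gamma> e)"
  using assms unfolding linked_def by (blast intro: r_into_rtrancl)+

lemma linked_lift: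
  assumes "linked \<Gamma> F u w"
    and "\<And>e. e \<in> F \<Longrightarrow> linked \<Gamma>' F' (tail \<Gamma> e) (head \<Gamma> e)"
  shows "linked \<Gamma>' F' u w"
  using assms(1) unfolding linked_def[of \<Gamma>]
proof (induction rule: rtrancl_induct)
  case (step y z)
  then have "linked \<Gamma>' F' y z"
    using assms(2) linked_sym by fastforce
  with step.IH show ?case by (rule linked_trans)
qed simp

lemma connected_edges_iff_linked:
  "connected_edges \<Gamma> F \<longleftrightarrow>
    F \<noteq> {} \<and> (\<forall>u\<in>tail \<Gamma> ` F \<union> head \<Gamma> ` F. \<forall>w\<in>tail \<Gamma> ` F \<union> head \<Gamma> ` F. linked \<Gamma> F u w)"
proof -
  let ?V = "tail \<Gamma> ` F \<union> head \<Gamma> ` F"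
  let ?R = "\<Union>e\<in>F. {(tail \<Gamma> e, head \<Gamma> e), (head \<Gamma> e, tail \<Gamma> e)}"
  have ends: "arcs_ends (with_proj (mk_symmetric (edge_union \<Gamma> F))) = ?R"
    by (auto simp: arcs_ends_def arc_to_ends_def mk_symmetric_def edge_union_def)
  have "(u, w) \<in> rtrancl_on ?V ?R \<longleftrightarrow> (u, w) \<in> ?R\<^sup>*" if "u \<in> ?V" for u w
  proof
    show "(u, w) \<in> ?R\<^sup>*" if "(u, w) \<in> rtrancl_on ?V ?R"
      using that by (induction rule: rtrancl_on_induct) (auto intro: rtrancl_into_rtrancl)
    show "(u, w) \<in> rtrancl_on ?V ?R" if "(u, w) \<in> ?R\<^sup>*"
      using that
    proof (induction rule: rtrancl_induct)
      case base
      show ?case using \<open>u \<in> ?V\<close> by (rule rtrancl_on_refl)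
    next
      case (step y z)
      then have "z \<in> ?V" by auto
      with step show ?case by (blast intro: rtrancl_on_into_rtrancl_on)
    qed
  qed
  then show ?thesis
    unfolding connected_edges_def Digraph_Component.connected_def strongly_connected_def
      reachable_def ends linked_def
    by (auto simp: edge_union_def mk_symmetric_def)
qed

text \<open>
  It suffices to reach the tail of each edge from one common vertex \<open>h\<close>, for then the heads are
  reached too.
\<close>

lemma connected_edgesI:
  assumes "F \<noteq> {}" and "\<And>e. e \<in> F \<Longrightarrow> linked \<Gamma> F h (tail \<Gamma> e)"
  shows "connected_edges \<Gamma> F"
proof -
  have "linked \<Gamma> F h u" if "u \<in> tail \<Gamma> ` F \<union> head \<Gamma> ` F" for u
    using that assms(2) linked_edge(1) linked_trans by fastforce
  then show ?thesis
    using assms(1) linked_sym linked_trans unfolding connected_edges_iff_linked by meson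
qed

section \<open>The first Betti number from the complement of a spanning tree\<close>

definition cycle_space :: "('v, 'e) pre_digraph \<Rightarrow> ('e \<Rightarrow> rat) set" where
  "cycle_space \<Gamma> = {f. (\<forall>e. e \<notin> arcs \<Gamma> \<longrightarrow> f e = 0) \<and> (\<forall>v\<in>verts \<Gamma>. boundary \<Gamma> f v = 0)}"

text \<open>
  The complement of a spanning tree has this property: a cycle is determined by its values there,
  and the fundamental cycles realize the unit vectors. The property is stated without trees, as
  only these two consequences matter for the dimension and both are easy to carry along a truncation.
\<close>

definition cycle_coordinates :: "('v, 'e) pre_digraph \<Rightarrow> 'e set \<Rightarrow> bool" where
  "cycle_coordinates \<Gamma> B \<longleftrightarrow> finite B \<and> B \<subseteq> arcs \<Gamma> \<and>
    (\<forall>f\<in>cycle_space \<Gamma>. (\<forall>x\<in>B. f x = 0) \<longrightarrow> f = 0) \<and>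
    (\<forall>x\<in>B. \<exists>f\<in>cycle_space \<Gamma>. \<forall>y\<in>B. f y = of_bool (y = x))"

lemma sum_fun_apply: "(\<Sum>x\<in>A. g x) e = (\<Sum>x\<in>A. g x e)" for g :: "'a \<Rightarrow> 'b \<Rightarrow> rat"
  by (induction A rule: infinite_finite_induct) auto

lemma boundary_diff: "boundary \<Gamma> (f - g) v = boundary \<Gamma> f v - boundary \<Gamma> g v"
  by (simp add: boundary_def sum_subtractf)

lemma boundary_sum:
  "boundary \<Gamma> (\<lambda>e. \<Sum>x\<in>B. a x * f x e) v = (\<Sum>x\<in>B. a x * boundary \<Gamma> (f x) v)"
proof -
  have "(\<Sum>e\<in>A. \<Sum>x\<in>B. a x * f x e) = (\<Sum>x\<in>B. a x * (\<Sum>e\<in>A. f x e))" for A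
    by (subst sum.swap) (simp add: sum_distrib_left)
  then show ?thesis
    by (simp add: boundary_def right_diff_distrib sum_subtractf)
qed

text \<open>
  The cycles \<open>z x\<close> that restrict to the unit vectors on \<open>B\<close> form a basis: a linear combination has
  its coefficients as values on \<open>B\<close>, and a cycle minus the combination with the same values on
  \<open>B\<close> vanishes on \<open>B\<close>.
\<close>

lemma first_betti_eq_card:
  assumes "cycle_coordinates \<Gamma> B"
  shows "first_betti \<Gamma> = card B"
proof -
  let ?Z = "cycle_space \<Gamma>"
  have fin: "finite B" and faithful: "\<And>f. f \<in> ?Z \<Longrightarrow> \<forall>x\<in>B. f x = 0 \<Longrightarrow> f = 0"
    using assms by (auto simp: cycle_coordinates_def)
  have "\<forall>x\<in>B. \<exists>f. f \<in> ?Z \<and> (\<forall>y\<in>B. f y = of_bool (y = x))"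
    using assms unfolding cycle_coordinates_def by blast
  then obtain z where z: "\<And>x. x \<in> B \<Longrightarrow> z x \<in> ?Z"
    and dual: "\<And>x y. x \<in> B \<Longrightarrow> y \<in> B \<Longrightarrow> z x y = of_bool (y = x)"
    by (metis (no_types, lifting))
  have inj: "inj_on z B"
  proof (rule inj_onI)
    fix x y assume "x \<in> B" "y \<in> B" "z x = z y"
    then have "of_bool (x = x) = (of_bool (x = y) :: rat)"
      using dual[of x x] dual[of y x] by simp
    then show "x = y" by (simp split: if_splits)
  qed
  have comb: "(\<Sum>w\<in>z ` B. (\<lambda>e. u w * w e)) = (\<lambda>e. \<Sum>x\<in>B. u (z x) * z x e)" for u
    by (simp add: sum.reindex[OF inj] fun_eq_iff sum_fun_apply)
  have coord: "(\<Sum>x\<in>B. a x * z x y) = a y" if "y \<in> B" for a y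
  proof -
    have "(\<Sum>x\<in>B. a x * z x y) = (\<Sum>x\<in>B. if x = y then a x else 0)"
      using that dual by (intro sum.cong) auto
    then show ?thesis using fin that by simp
  qed
  have "chains.independent (z ` B)"
  proof (subst chains.dependent_finite[OF finite_imageI[OF fin]], safe)
    fix u y
    assume zero: "(\<Sum>w\<in>z ` B. (\<lambda>e. u w * w e)) = 0" and y: "y \<in> B" "u (z y) \<noteq> 0"
    have "(\<Sum>x\<in>B. u (z x) * z x y) = 0"
      using fun_cong[OF zero, of y] unfolding comb by simp
    with coord[OF y(1), of "\<lambda>x. u (z x)"] y(2) show False by simp
  qed
  moreover have "?Z \<subseteq> chains.span (z ` B)"
  proof
    fix f assume f: "f \<in> ?Z"
    let ?g = "\<lambda>e. \<Sum>x\<in>B. f x * z x e"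
    have "f - ?g \<in> ?Z"
    proof -
      have "f e - ?g e = 0" if "e \<notin> arcs \<Gamma>" for e
        using that f z by (simp add: cycle_space_def)
      moreover have "boundary \<Gamma> (f - ?g) v = 0" if "v \<in> verts \<Gamma>" for v
        using that f z by (simp add: cycle_space_def boundary_diff boundary_sum)
      ultimately show ?thesis by (simp add: cycle_space_def)
    qed
    then have "f - ?g = 0"
      using coord by (intro faithful) auto
    then have "f = ?g" by simp
    also have "?g = (\<Sum>w\<in>z ` B. (\<lambda>e. f (the_inv_into B z w) * w e))"
      unfolding comb by (intro ext sum.cong) (auto simp: the_inv_into_f_f[OF inj])
    also have "\<dots> \<in> chains.span (z ` B)"
      by (intro chains.span_sum chains.span_scale chains.span_base)
    finally show "f \<in> chains.span (z ` B)" .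
  qed
  moreover have "z ` B \<subseteq> ?Z" using z by auto
  ultimately have "chains.dim ?Z = card (z ` B)"
    by (intro chains.dim_unique) auto
  then show ?thesis
    by (simp add: first_betti_def cycle_space_def card_image[OF inj])
qed

section \<open>Truncating a vertex\<close>

text \<open>
  Truncation is only described at vertices that two edges enter and one edge leaves. This
  orientation is restored by the truncation, so the process can be repeated at the same vertex.
\<close>

definition corner :: "('v, 'e) pre_digraph \<Rightarrow> 'v \<Rightarrow> 'e \<Rightarrow> 'e \<Rightarrow> bool" where
  "corner \<Gamma> v e f \<longleftrightarrow> v \<in> verts \<Gamma> \<and> in_arcs \<Gamma> v = {e, f} \<and> e \<noteq> f"

text \<open>
  The vertices of the triangle are \<open>v\<close>, \<open>x\<close> and \<open>y\<close>. The old edges \<open>e\<close> and \<open>f\<close> keep their tails and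
  now end in \<open>x\<close> and \<open>y\<close>, and the old edge leaving \<open>v\<close> stays as it is. The triangle consists of \<open>e'\<close>
  from \<open>x\<close> to \<open>v\<close>, \<open>f'\<close> from \<open>y\<close> to \<open>v\<close>, and \<open>r\<close> from \<open>x\<close> to \<open>y\<close>.
\<close>

locale truncation =
  fixes \<Gamma> :: "('v, 'e) pre_digraph" and v x y :: 'v and e f e' f' r :: 'e
  assumes trivalent: "trivalent \<Gamma>"
    and corner: "corner \<Gamma> v e f"
    and new_verts: "x \<notin> verts \<Gamma>" "y \<notin> verts \<Gamma>" "x \<noteq> y"
    and new_arcs: "e' \<notin> arcs \<Gamma>" "f' \<notin> arcs \<Gamma>" "r \<notin> arcs \<Gamma>" "e' \<noteq> f'" "e' \<noteq> r" "f' \<noteq> r"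
begin

definition truncated :: "('v, 'e) pre_digraph" where
  "truncated = \<lparr>verts = {x, y} \<union> verts \<Gamma>, arcs = {e', f', r} \<union> arcs \<Gamma>,
    tail = (tail \<Gamma>)(e' := x, f' := y, r := x),
    head = (head \<Gamma>)(e := x, f := y, e' := v, f' := v, r := y)\<rparr>"

sublocale fin_digraph \<Gamma>
  using trivalent by (simp add: trivalent_def)

lemma old: "v \<in> verts \<Gamma>" "e \<in> arcs \<Gamma>" "f \<in> arcs \<Gamma>" "e \<noteq> f"
  and head_v: "head \<Gamma> e = v" "head \<Gamma> f = v"
  and in_arcs_v: "in_arcs \<Gamma> v = {e, f}"
  using corner unfolding corner_def in_arcs_def by auto

lemma distinct_names: "x \<noteq> v" "y \<noteq> v" "y \<noteq> x" "e \<noteq> e'" "e \<noteq> f'" "e \<noteq> r" "f \<noteq> e'" "f \<noteq> f'" "f \<noteq> r"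
  "f \<noteq> e" "f' \<noteq> e'" "r \<noteq> e'" "r \<noteq> f'"
  using old new_verts new_arcs by auto

lemma truncated_simps [simp]:
  "verts truncated = {x, y} \<union> verts \<Gamma>" "arcs truncated = {e', f', r} \<union> arcs \<Gamma>"
  "tail truncated e' = x" "tail truncated f' = y" "tail truncated r = x"
  "head truncated e' = v" "head truncated f' = v" "head truncated r = y"
  "head truncated e = x" "head truncated f = y"
  using distinct_names old new_arcs by (simp_all add: truncated_def)

lemma tail_old: "a \<in> arcs \<Gamma> \<Longrightarrow> tail truncated a = tail \<Gamma> a"
  using new_arcs by (auto simp: truncated_def)

lemma head_old: "a \<in> arcs \<Gamma> \<Longrightarrow> a \<noteq> e \<Longrightarrow> a \<noteq> f \<Longrightarrow> head truncated a = head \<Gamma> a"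
  using new_arcs by (auto simp: truncated_def)

lemma head_old_cases:
  "a \<in> arcs \<Gamma> \<Longrightarrow> head truncated a = (if a = e then x else if a = f then y else head \<Gamma> a)"
  by (auto simp: head_old)

lemma in_arcs_truncated:
  "in_arcs truncated x = {e}" "in_arcs truncated y = {f, r}" "in_arcs truncated v = {e', f'}"
  "u \<in> verts \<Gamma> \<Longrightarrow> u \<noteq> v \<Longrightarrow> in_arcs truncated u = in_arcs \<Gamma> u"
proof -
  have *: "a \<in> in_arcs truncated u \<longleftrightarrow>
      (a = e' \<or> a = f') \<and> u = v \<or> a = r \<and> u = y \<or> a = e \<and> u = x \<or> a = f \<and> u = y \<or>
      a \<in> arcs \<Gamma> \<and> a \<noteq> e \<and> a \<noteq> f \<and> head \<Gamma> a = u" for a u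
    using old new_arcs by (auto simp: in_arcs_def head_old_cases head_v split: if_splits)
  have "a = e \<or> a = f" if "a \<in> arcs \<Gamma>" "head \<Gamma> a = v" for a
    using that in_arcs_v by (auto simp: in_arcs_def)
  then show "in_arcs truncated v = {e', f'}"
    using distinct_names unfolding set_eq_iff * by auto
  show "in_arcs truncated x = {e}" "in_arcs truncated y = {f, r}"
    using distinct_names old new_verts head_in_verts unfolding set_eq_iff * by auto
  show "in_arcs truncated u = in_arcs \<Gamma> u" if "u \<in> verts \<Gamma>" "u \<noteq> v"
    using that new_verts head_v unfolding set_eq_iff * by (auto simp: in_arcs_def)
qed

lemma out_arcs_truncated:
  "out_arcs truncated x = {e', r}" "out_arcs truncated y = {f'}"
  "u \<in> verts \<Gamma> \<Longrightarrow> out_arcs truncated u = out_arcs \<Gamma> u"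
proof -
  have *: "a \<in> out_arcs truncated u \<longleftrightarrow>
      (a = e' \<or> a = r) \<and> u = x \<or> a = f' \<and> u = y \<or> a \<in> arcs \<Gamma> \<and> tail \<Gamma> a = u" for a u
    using new_arcs by (auto simp: out_arcs_def tail_old)
  show "out_arcs truncated x = {e', r}" "out_arcs truncated y = {f'}"
    using distinct_names new_verts tail_in_verts unfolding set_eq_iff * by auto
  show "out_arcs truncated u = out_arcs \<Gamma> u" if "u \<in> verts \<Gamma>"
    using that new_verts unfolding set_eq_iff * by (auto simp: out_arcs_def)
qed

lemma trivalent_truncated: "Defs.trivalent truncated"
proof -
  have "fin_digraph truncated"
    using old by unfold_locales (auto simp: tail_old head_old_cases)
  moreover have "card (in_arcs truncated u) + card (out_arcs truncated u) = 3"
    if "u \<in> verts truncated" for u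
  proof (cases "u \<in> verts \<Gamma>")
    case True
    have "card (in_arcs truncated u) = card (in_arcs \<Gamma> u)"
      using True distinct_names by (cases "u = v") (simp_all add: in_arcs_truncated in_arcs_v)
    with True trivalent show ?thesis
      by (simp add: out_arcs_truncated Defs.trivalent_def)
  next
    case False
    with that consider "u = x" | "u = y" by auto
    then show ?thesis
      using distinct_names by cases (simp_all add: in_arcs_truncated out_arcs_truncated)
  qed
  ultimately show ?thesis by (simp add: Defs.trivalent_def)
qed

lemma corner_truncated: "corner truncated v e' f'"
  using old new_arcs by (simp add: corner_def in_arcs_truncated)

lemma other_corner: "corner \<Gamma> w a b \<Longrightarrow> w \<noteq> v \<Longrightarrow> corner truncated w a b"
  by (simp add: corner_def in_arcs_truncated)

lemma out_arc_v: obtains d where "out_arcs \<Gamma> v = {d}"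
proof -
  have "card (in_arcs \<Gamma> v) + card (out_arcs \<Gamma> v) = 3"
    using trivalent old by (simp add: Defs.trivalent_def)
  then have "card (out_arcs \<Gamma> v) = 1"
    using old by (simp add: in_arcs_v)
  then show ?thesis
    using that by (auto simp: card_1_singleton_iff)
qed

text \<open>
  Conservation at \<open>x\<close> and \<open>y\<close> expresses the values on \<open>e'\<close> and \<open>f'\<close> by those on \<open>e\<close>, \<open>f\<close> and \<open>r\<close>.
  When they are substituted at \<open>v\<close>, the contributions of \<open>r\<close> cancel and conservation at \<open>v\<close> in the
  old graph remains. So the cycles of the truncated graph are those of the old one together with a
  free value on \<open>r\<close>.
\<close>

lemma cycle_space_truncated_iff:
  "g \<in> cycle_space truncated \<longleftrightarrow>
    (\<lambda>a. if a \<in> arcs \<Gamma> then g a else 0) \<in> cycle_space \<Gamma> \<and>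
    (\<forall>a. a \<notin> arcs truncated \<longrightarrow> g a = 0) \<and> g e' = g e - g r \<and> g f' = g f + g r"
proof -
  define h where "h = (\<lambda>a. if a \<in> arcs \<Gamma> then g a else 0)"
  have in_sum: "(\<Sum>a\<in>in_arcs \<Gamma> u. h a) = (\<Sum>a\<in>in_arcs \<Gamma> u. g a)"
    and out_sum: "(\<Sum>a\<in>out_arcs \<Gamma> u. h a) = (\<Sum>a\<in>out_arcs \<Gamma> u. g a)" for u
    by (rule sum.cong; simp add: h_def in_arcs_def out_arcs_def)+
  have h_old: "h e = g e" "h f = g f"
    using old by (simp_all add: h_def)
  have bx: "boundary truncated g x = g e - (g e' + g r)"
    and by': "boundary truncated g y = g f + g r - g f'"
    and bv: "boundary truncated g v = boundary \<Gamma> h v - (g e + g f) + (g e' + g f')"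
    and bu: "\<And>u. u \<in> verts \<Gamma> \<Longrightarrow> u \<noteq> v \<Longrightarrow> boundary truncated g u = boundary \<Gamma> h u"
    using old distinct_names
    by (simp_all add: boundary_def in_arcs_truncated out_arcs_truncated in_sum out_sum in_arcs_v h_old)
  have "(\<forall>u\<in>verts truncated. boundary truncated g u = 0) \<longleftrightarrow>
      (\<forall>u\<in>verts \<Gamma>. boundary \<Gamma> h u = 0) \<and> g e' = g e - g r \<and> g f' = g f + g r" (is "?L \<longleftrightarrow> ?R")
  proof
    assume L: ?L
    then have eqs: "g e' = g e - g r" "g f' = g f + g r"
      using bx by' by auto
    have "boundary \<Gamma> h u = 0" if "u \<in> verts \<Gamma>" for u
    proof (cases "u = v")
      case True
      have "boundary truncated g v = 0" using L old by simp
      with eqs show ?thesis unfolding bv True by simp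
    next
      case False
      with L that bu show ?thesis by auto
    qed
    with eqs show ?R by simp
  next
    assume R: ?R
    then have "boundary truncated g u = 0" if "u \<in> verts \<Gamma>" for u
      using that bu[OF that] bv old by (cases "u = v") auto
    with R bx by' show ?L by auto
  qed
  then show ?thesis
    unfolding cycle_space_def h_def[symmetric] by (auto simp: h_def)
qed

lemma cycle_coordinates_truncated:
  assumes "cycle_coordinates \<Gamma> B"
  shows "cycle_coordinates truncated (insert r B)"
proof -
  have B: "finite B" "B \<subseteq> arcs \<Gamma>"
    using assms by (auto simp: cycle_coordinates_def)
  have "g = 0" if g: "g \<in> cycle_space truncated" and zero: "\<forall>a\<in>insert r B. g a = 0" for g
  proof -
    \<comment> \<open>The restriction to the old edges is a cycle that vanishes on \<open>B\<close>.\<close>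
    let ?h = "\<lambda>a. if a \<in> arcs \<Gamma> then g a else 0"
    have "?h \<in> cycle_space \<Gamma>" using g by (simp add: cycle_space_truncated_iff)
    moreover have "\<forall>a\<in>B. ?h a = 0" using zero by simp
    ultimately have "?h = 0" using assms by (simp add: cycle_coordinates_def)
    then have "g a = 0" if "a \<in> arcs \<Gamma>" for a
      using that fun_cong[of ?h 0 a] by simp
    moreover from this have "g a = 0" if "a \<in> {e', f', r}" for a
      using that g zero old by (auto simp: cycle_space_truncated_iff)
    moreover have "g a = 0" if "a \<notin> arcs truncated" for a
      using that g by (simp add: cycle_space_truncated_iff)
    ultimately have "g a = 0" for a
      by (cases "a \<in> arcs truncated") (simp only: truncated_simps; blast)+
    then show "g = 0" by (simp add: fun_eq_iff)
  qed
  moreover have "\<exists>g\<in>cycle_space truncated. \<forall>b\<in>insert r B. g b = of_bool (b = a)"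
    if a: "a \<in> insert r B" for a
  proof -
    have zero: "0 \<in> cycle_space \<Gamma>" by (simp add: cycle_space_def boundary_def)
    \<comment> \<open>The unit vector at \<open>r\<close> is the boundary of the triangle, which extends \<open>h = 0\<close>; the others
      extend old cycles by the value 0 on \<open>r\<close>.\<close>
    obtain h where h: "h \<in> cycle_space \<Gamma>" "\<forall>b\<in>B. h b = of_bool (b = a)"
    proof (cases "a = r")
      case True
      with new_arcs B have "\<forall>b\<in>B. (0::_ \<Rightarrow> rat) b = of_bool (b = a)" by auto
      with zero that show thesis by blast
    next
      case False
      with a assms that show thesis unfolding cycle_coordinates_def by blast
    qed
    define k :: rat where "k = of_bool (r = a)"
    let ?g = "h(r := k, e' := h e - k, f' := h f + k)"
    have out: "h b = 0" if "b \<notin> arcs \<Gamma>" for b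
      using h(1) that by (simp add: cycle_space_def)
    have "(\<lambda>b. if b \<in> arcs \<Gamma> then ?g b else 0) = h"
      using new_arcs out by auto
    then have "?g \<in> cycle_space truncated"
      using h(1) out distinct_names by (simp add: cycle_space_truncated_iff)
    moreover have "\<forall>b\<in>insert r B. ?g b = of_bool (b = a)"
      using h(2) B new_arcs by (auto simp: k_def)
    ultimately show ?thesis by blast
  qed
  ultimately show ?thesis
    using B by (auto simp: cycle_coordinates_def)
qed

text \<open>
  Two sides of the triangle keep \<open>v\<close>, \<open>x\<close> and \<open>y\<close> together, so every old path can be repaired where
  it used \<open>e\<close> or \<open>f\<close>. If \<open>F\<close> contains \<open>e\<close> or \<open>f\<close>, then the triangle is also attached to the old part.
\<close>

lemma connected_truncated:
  assumes conn: "connected_edges \<Gamma> F" and sub: "F \<subseteq> arcs \<Gamma>"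
    and meets: "e \<in> F \<or> f \<in> F"
    and N: "N \<subseteq> {e', f', r}" "{e', f', r} - {k} \<subseteq> N"
  shows "connected_edges truncated (F \<union> N)"
proof (rule connected_edgesI)
  let ?L = "linked truncated (F \<union> N)"
  show "F \<union> N \<noteq> {}" using meets by auto
  have "?L v x \<and> ?L v y"
  proof -
    have e': "?L x v" if "k \<noteq> e'"
      using linked_edge(1)[of e' "F \<union> N" truncated] N that by auto
    have f': "?L y v" if "k \<noteq> f'"
      using linked_edge(1)[of f' "F \<union> N" truncated] N that by auto
    have r: "?L x y" if "k \<noteq> r"
      using linked_edge(1)[of r "F \<union> N" truncated] N that distinct_names by auto
    show ?thesis
      using e' f' r distinct_names by (metis linked_sym linked_trans)
  qed
  then have x: "?L x v" "?L v x" and y: "?L y v" "?L v y"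
    by (auto intro: linked_sym)
  fix a assume "a \<in> F \<union> N"
  then consider "a \<in> F" | "a \<in> N" by blast
  then show "?L v (tail truncated a)"
  proof cases
    case 1
    have "linked \<Gamma> F v (tail \<Gamma> a)"
      using conn meets head_v 1 unfolding connected_edges_iff_linked by (metis UnCI image_eqI)
    then have "?L v (tail \<Gamma> a)"
    proof (rule linked_lift)
      fix b assume b: "b \<in> F"
      have step: "?L (tail truncated b) (head truncated b)"
        using b by (intro linked_edge) simp
      have "?L (head truncated b) (head \<Gamma> b)"
        using b sub x y by (auto simp: head_old_cases head_v)
      with step have "?L (tail truncated b) (head \<Gamma> b)" by (rule linked_trans)
      then show "?L (tail \<Gamma> b) (head \<Gamma> b)"
        using b sub by (auto simp: tail_old)
    qed
    with 1 sub show ?thesis by (auto simp: tail_old)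
  next
    case 2
    with N x y show ?thesis by auto
  qed
qed

end

section \<open>Circuits under truncation\<close>

text \<open>
  The lists that witness a circuit are kept explicit, because a circuit is extended at the seam
  between the last edge and the first vertex.
\<close>

definition traverses :: "('v, 'e) pre_digraph \<Rightarrow> 'e list \<Rightarrow> 'v list \<Rightarrow> bool" where
  "traverses \<Gamma> es vs \<longleftrightarrow> set es \<subseteq> arcs \<Gamma> \<and> es \<noteq> [] \<and> length vs = length es \<and>
    distinct es \<and> distinct vs \<and>
    (\<forall>i<length es. {tail \<Gamma> (es ! i), head \<Gamma> (es ! i)} = {vs ! i, vs ! (Suc i mod length es)})"

lemma m_circuit_if_traverses: "traverses \<Gamma> es vs \<Longrightarrow> m_circuit \<Gamma> (length es) (set es)"
  unfolding m_circuit_def circuit_def traverses_def by (auto simp: distinct_card)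

context truncation
begin

lemma traverses_truncated:
  assumes "traverses \<Gamma> es vs" and "e \<notin> set es" "f \<notin> set es"
  shows "traverses truncated es vs"
proof -
  have "tail truncated (es ! i) = tail \<Gamma> (es ! i) \<and> head truncated (es ! i) = head \<Gamma> (es ! i)"
    if "i < length es" for i
  proof -
    have "es ! i \<in> set es" using that by simp
    then have "es ! i \<in> arcs \<Gamma>" "es ! i \<noteq> e" "es ! i \<noteq> f"
      using assms by (auto simp: traverses_def)
    then show ?thesis by (simp add: tail_old head_old)
  qed
  with assms(1) show ?thesis by (auto simp: traverses_def)
qed

text \<open>
  The circuit closes up by running along \<open>f\<close> to \<open>v\<close>. After the truncation, \<open>f\<close> leads to \<open>y\<close>, and \<open>f'\<close>
  continues from there to \<open>v\<close>.
\<close>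

lemma traverses_truncated_snoc:
  assumes trav: "traverses \<Gamma> es vs" and e: "e \<notin> set es" and f: "last es = f" and v: "hd vs = v"
  shows "traverses truncated (es @ [f']) (vs @ [y])"
proof -
  let ?n = "length es"
  have es: "set es \<subseteq> arcs \<Gamma>" "distinct es" "?n > 0" and vs: "length vs = ?n" "distinct vs"
    and ends: "\<And>i. i < ?n \<Longrightarrow>
      {tail \<Gamma> (es ! i), head \<Gamma> (es ! i)} = {vs ! i, vs ! (Suc i mod ?n)}"
    using trav by (auto simp: traverses_def)
  have v0: "vs ! 0 = v" and fn: "es ! (?n - 1) = f"
    using v f es vs hd_conv_nth[of vs] last_conv_nth[of es] by force+
  have "w \<in> verts \<Gamma>" if w: "w \<in> set vs" for w
  proof -
    obtain i where "i < ?n" "w = vs ! i"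
      using w vs by (auto simp: in_set_conv_nth)
    moreover from this have "es ! i \<in> arcs \<Gamma>" using es nth_mem by blast
    ultimately show ?thesis
      using ends[of i] tail_in_verts head_in_verts by (metis doubleton_eq_iff)
  qed
  then have y: "y \<notin> set vs" using new_verts by blast
  have "{tail truncated ((es @ [f']) ! i), head truncated ((es @ [f']) ! i)} =
      {(vs @ [y]) ! i, (vs @ [y]) ! (Suc i mod Suc ?n)}" if i: "i < Suc ?n" for i
  proof -
    consider "i = ?n" | "i = ?n - 1" "i < ?n" | "i < ?n - 1"
      using i by linarith
    then show ?thesis
    proof cases
      case 1
      then show ?thesis using vs es v0 by (auto simp: nth_append)
    next
      case 2
      then have "Suc i = ?n" by simp
      then have "{tail \<Gamma> f, v} = {vs ! i, v}"
        using ends[of i] 2 fn v0 head_v by simp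
      then have "tail \<Gamma> f = vs ! i" by (auto simp: doubleton_eq_iff)
      then show ?thesis
        using 2 \<open>Suc i = ?n\<close> fn vs old by (simp add: nth_append tail_old)
    next
      case 3
      have "es ! i \<in> arcs \<Gamma>" "es ! i \<noteq> e"
        using 3 es e nth_mem[of i es] by auto
      moreover have "es ! i \<noteq> f"
        using 3 es fn nth_eq_iff_index_eq[of es i "?n - 1"] by auto
      moreover have "Suc i < ?n" using 3 by simp
      ultimately show ?thesis
        using ends[of i] vs by (simp add: nth_append tail_old head_old)
    qed
  qed
  then show ?thesis
    using es vs y new_arcs by (auto simp: traverses_def)
qed

end

section \<open>Colorings by elementary abelian 2-groups\<close>

locale elementary_abelian_2_group = group G for G (structure) +
  assumes square: "a \<in> carrier G \<Longrightarrow> a \<otimes> a = \<one>"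
begin

lemma inv_self: "a \<in> carrier G \<Longrightarrow> inv a = a"
  by (simp add: inv_equality square)

sublocale comm_group
proof (rule group_comm_groupI)
  fix a b assume "a \<in> carrier G" "b \<in> carrier G"
  then show "a \<otimes> b = b \<otimes> a"
    using inv_mult_group[of a b] by (simp add: inv_self)
qed

lemma square_cancel: "a \<in> carrier G \<Longrightarrow> b \<in> carrier G \<Longrightarrow> a \<otimes> (a \<otimes> b) = b"
  by (simp add: m_assoc[symmetric] square)

lemma mult_eq_one_iff:
  "a \<in> carrier G \<Longrightarrow> b \<in> carrier G \<Longrightarrow> a \<otimes> b = \<one> \<longleftrightarrow> a = b"
  by (metis square square_cancel r_one)

end

locale colored_corner = truncation \<Gamma> v x y e f e' f' r + elementary_abelian_2_group G
  for G (structure) and \<Gamma> :: "('v, 'e) pre_digraph" and v x y e f e' f' r +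
  fixes c :: "'e \<Rightarrow> 'a"
  assumes coloring: "coloring G \<Gamma> c"
begin

lemma color: "a \<in> arcs \<Gamma> \<Longrightarrow> c a \<in> carrier G" "a \<in> arcs \<Gamma> \<Longrightarrow> c a \<noteq> \<one>"
  using coloring by (auto simp: coloring_def)

lemma colors_at_corner: "c e \<in> carrier G" "c f \<in> carrier G" "c e \<noteq> c f"
  and finprod_out_v: "finprod G c (out_arcs \<Gamma> v) = c e \<otimes> c f"
proof -
  show ef: "c e \<in> carrier G" "c f \<in> carrier G"
    using color old by auto
  obtain d where d: "out_arcs \<Gamma> v = {d}" by (rule out_arc_v)
  then have "d \<in> arcs \<Gamma>" by (auto simp: out_arcs_def)
  note cd = color[OF this]
  have "finprod G c {e, f} \<otimes> finprod G c {d} = \<one>"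
    using coloring old d in_arcs_v by (auto simp: coloring_def)
  then have "(c e \<otimes> c f) \<otimes> c d = \<one>"
    using ef cd old by simp
  then have "c d = c e \<otimes> c f"
    using ef cd by (simp add: mult_eq_one_iff)
  then show "finprod G c (out_arcs \<Gamma> v) = c e \<otimes> c f" "c e \<noteq> c f"
    using d cd ef by (auto simp: square)
qed

end

text \<open>
  The edge leaving \<open>v\<close> has color \<open>c e \<otimes> c f\<close>, so \<open>s\<close> differs from all colors at \<open>v\<close>. This says
  precisely that no side of the triangle gets color \<open>\<one>\<close>.
\<close>

locale colored_truncation = colored_corner +
  fixes s
  assumes s: "s \<in> carrier G" "s \<noteq> c e" "s \<noteq> c f" "s \<noteq> c e \<otimes> c f"
begin

text \<open>
  Each side of the triangle carries \<open>s\<close> times the color of the old edge at the opposite corner.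
\<close>

definition truncated_coloring where
  "truncated_coloring = c(e' := s \<otimes> c f, f' := s \<otimes> c e, r := s \<otimes> (c e \<otimes> c f))"

lemma truncated_coloring_simps [simp]:
  "truncated_coloring e' = s \<otimes> c f" "truncated_coloring f' = s \<otimes> c e"
  "truncated_coloring r = s \<otimes> (c e \<otimes> c f)"
  using distinct_names by (simp_all add: truncated_coloring_def)

lemma truncated_coloring_old: "a \<in> arcs \<Gamma> \<Longrightarrow> truncated_coloring a = c a"
  using new_arcs by (auto simp: truncated_coloring_def)

lemma coloring_truncated: "Defs.coloring G truncated truncated_coloring"
proof -
  note [simp] = colors_at_corner(1,2) s(1)
  have mem: "truncated_coloring a \<in> carrier G - {\<one>}" if "a \<in> arcs truncated" for a
    using that color s by (auto simp: truncated_coloring_old mult_eq_one_iff)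
  have "finprod G truncated_coloring (in_arcs truncated u) \<otimes>
      finprod G truncated_coloring (out_arcs truncated u) = \<one>" if u: "u \<in> verts truncated" for u
  proof -
    have old_prod: "finprod G truncated_coloring A = finprod G c A" if "A \<subseteq> arcs \<Gamma>" for A
      using that color by (intro finprod_cong') (auto simp: truncated_coloring_old)
    have [simp]: "truncated_coloring e = c e" "truncated_coloring f = c f"
      using old by (auto simp: truncated_coloring_old)
    have out: "out_arcs \<Gamma> u \<subseteq> arcs \<Gamma>" "in_arcs \<Gamma> u \<subseteq> arcs \<Gamma>"
      by (auto simp: out_arcs_def in_arcs_def)
    consider "u = x" | "u = y" | "u = v" | "u \<in> verts \<Gamma>" "u \<noteq> v"
      using u by auto
    then show ?thesis
    proof cases
      case 1
      then show ?thesis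
        using distinct_names
        by (simp add: in_arcs_truncated out_arcs_truncated m_ac square square_cancel)
    next
      case 2
      then show ?thesis
        using distinct_names
        by (simp add: in_arcs_truncated out_arcs_truncated m_ac square square_cancel)
    next
      case 3
      then show ?thesis
        using distinct_names old out
        by (simp add: in_arcs_truncated out_arcs_truncated old_prod finprod_out_v
            m_ac square square_cancel)
    next
      case 4
      then show ?thesis
        using coloring out by (simp add: in_arcs_truncated out_arcs_truncated old_prod coloring_def)
    qed
  qed
  moreover have "generate G (truncated_coloring ` arcs truncated) = carrier G"
  proof
    show "generate G (truncated_coloring ` arcs truncated) \<subseteq> carrier G"
      using mem by (intro generate_incl) blast
    have "c ` arcs \<Gamma> \<subseteq> truncated_coloring ` arcs truncated"
      by (auto simp: truncated_coloring_old[symmetric])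
    then show "carrier G \<subseteq> generate G (truncated_coloring ` arcs truncated)"
      using mono_generate coloring unfolding coloring_def by metis
  qed
  ultimately show ?thesis
    using mem unfolding Defs.coloring_def by blast
qed

text \<open>
  The colors \<open>c e\<close>, \<open>c f\<close> and \<open>c e \<otimes> c f\<close> are distinct, hence so are those of the sides of the
  triangle. Deleting the edges of one color therefore removes at most one side, and at most one
  of \<open>e\<close> and \<open>f\<close>.
\<close>

lemma unsplittable_truncated:
  assumes "unsplittable G \<Gamma> c"
  shows "unsplittable G truncated truncated_coloring"
  unfolding unsplittable_def
proof
  fix g assume g: "g \<in> carrier G"
  let ?F = "{a \<in> arcs \<Gamma>. c a \<noteq> g}"
  let ?N = "{a \<in> {e', f', r}. truncated_coloring a \<noteq> g}"
  note [simp] = colors_at_corner(1,2) s(1)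
  have "c e \<noteq> c e \<otimes> c f" "c f \<noteq> c e \<otimes> c f"
    using color old by (auto simp: l_cancel_one' r_cancel_one')
  then have distinct_colors: "truncated_coloring e' \<noteq> truncated_coloring f'"
      "truncated_coloring e' \<noteq> truncated_coloring r" "truncated_coloring f' \<noteq> truncated_coloring r"
    using colors_at_corner(3) by auto
  define k where "k = (if truncated_coloring e' = g then e'
    else if truncated_coloring f' = g then f' else r)"
  have "{e', f', r} - {k} \<subseteq> ?N"
    using distinct_colors unfolding k_def by (auto simp del: truncated_coloring_simps)
  moreover have "connected_edges \<Gamma> ?F"
    using assms g by (simp add: unsplittable_def)
  moreover have "e \<in> ?F \<or> f \<in> ?F"
    using old colors_at_corner(3) by auto
  ultimately have "connected_edges truncated (?F \<union> ?N)"
    by (intro connected_truncated[where k = k]) auto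
  also have "?F \<union> ?N = {a \<in> arcs truncated. truncated_coloring a \<noteq> g}"
    by (auto simp: truncated_coloring_old)
  finally show "connected_edges truncated {a \<in> arcs truncated. truncated_coloring a \<noteq> g}" .
qed

lemma edges_outside_truncated:
  "edges_outside truncated truncated_coloring H =
    edges_outside \<Gamma> c H \<union> {a \<in> {e', f', r}. truncated_coloring a \<notin> H}"
  by (auto simp: edges_outside_def truncated_coloring_old)

end

section \<open>Models with a special circuit\<close>

locale order_8_group_with_index_2_subgroup = elementary_abelian_2_group +
  fixes H :: "'a set"
  assumes subgroup_H: "subgroup H G" and order: "order G = 8" and card_H: "card H = 4"
begin

lemma H_subset: "H \<subseteq> carrier G" and one_H: "\<one> \<in> H"
  using subgroup_H by (auto simp: subgroup.subset subgroup.one_closed)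

lemma finite_G: "finite (carrier G)"
  using order by (intro card_ge_0_finite) (simp add: order_def)

lemma card_outside: "card (carrier G - H) = 4"
  using order card_H H_subset finite_G by (simp add: card_Diff_subset finite_subset order_def)

lemma mult_in: "a \<in> H \<Longrightarrow> b \<in> H \<Longrightarrow> a \<otimes> b \<in> H"
  using subgroup_H by (rule subgroup.m_closed)

lemma mult_in_iff: "a \<in> carrier G \<Longrightarrow> b \<in> H \<Longrightarrow> a \<otimes> b \<in> H \<longleftrightarrow> a \<in> H"
proof -
  assume a: "a \<in> carrier G" and b: "b \<in> H"
  have "(a \<otimes> b) \<otimes> b = a"
    using a b H_subset by (simp add: m_assoc square subset_iff)
  then show ?thesis
    using mult_in b by metis
qed

text \<open>
  Multiplication by \<open>a\<close> maps \<open>H\<close> injectively into its complement, which has as many elements, so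
  every \<open>b\<close> outside \<open>H\<close> has the form \<open>a \<otimes> h\<close>.
\<close>

lemma mult_outside:
  assumes a: "a \<in> carrier G - H" and b: "b \<in> carrier G - H"
  shows "a \<otimes> b \<in> H"
proof -
  have "inj_on ((\<otimes>) a) H"
    using a H_subset by (intro inj_onI) (simp add: subset_iff)
  moreover have "(\<otimes>) a ` H \<subseteq> carrier G - H"
    using a H_subset mult_in_iff by auto
  ultimately have "(\<otimes>) a ` H = carrier G - H"
    using card_H card_outside finite_G by (intro card_subset_eq) (simp_all add: card_image)
  then obtain h where "h \<in> H" "b = a \<otimes> h"
    using b by auto
  then show ?thesis
    using a H_subset by (auto simp: square_cancel)
qed

lemma index2: "H \<in> index2_subgroups G"
  using lagrange[OF subgroup_H] subgroup_H order card_H by (simp add: index2_subgroups_def)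

text \<open>
  Two distinct nontrivial elements generate \<open>H\<close>, a group of order 4 and exponent 2, and any further
  element reaches the other coset.
\<close>

lemma generate_eq_carrier:
  assumes "{q, r, t} \<subseteq> S" "S \<subseteq> carrier G"
    and qr: "q \<in> H" "r \<in> H" "q \<noteq> \<one>" "r \<noteq> \<one>" "q \<noteq> r" and t: "t \<in> carrier G - H"
  shows "generate G S = carrier G"
proof
  show "generate G S \<subseteq> carrier G" using assms by (intro generate_incl)
  have gen: "q \<in> generate G S" "r \<in> generate G S" "t \<in> generate G S"
    using assms by (auto intro: generate.incl)
  have [simp]: "q \<in> carrier G" "r \<in> carrier G" using qr H_subset by auto
  have "q \<otimes> r \<noteq> \<one>" "q \<otimes> r \<noteq> q" "q \<otimes> r \<noteq> r"
    using qr by (simp_all add: mult_eq_one_iff)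
  then have "card {\<one>, q, r, q \<otimes> r} = 4"
    using qr by (auto simp: card_insert_if)
  then have "H = {\<one>, q, r, q \<otimes> r}"
    using qr card_H finite_G H_subset one_H mult_in
    by (intro card_subset_eq[symmetric]) (auto intro: finite_subset)
  then have H: "H \<subseteq> generate G S"
    using gen by (auto intro: generate.one generate.eng)
  show "carrier G \<subseteq> generate G S"
  proof
    fix a assume a: "a \<in> carrier G"
    show "a \<in> generate G S"
    proof (cases "a \<in> H")
      case False
      then have "t \<otimes> a \<in> generate G S"
        using a t H mult_outside by auto
      then have "t \<otimes> (t \<otimes> a) \<in> generate G S"
        by (rule generate.eng[OF gen(3)])
      then show ?thesis using a t by (simp add: square_cancel)
    qed (use H in blast)
  qed
qed

text \<open>
  The invariant of the construction: the circuit of all edges with a color outside \<open>H\<close> is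
  traversed by \<open>es\<close> and \<open>vs\<close>, and the first Betti number is \<open>b\<close>.
\<close>

definition special_model ::
  "('v, 'e) pre_digraph \<Rightarrow> ('e \<Rightarrow> 'a) \<Rightarrow> 'e list \<Rightarrow> 'v list \<Rightarrow> nat \<Rightarrow> bool" where
  "special_model \<Gamma> c es vs b \<longleftrightarrow> trivalent \<Gamma> \<and> (\<exists>B. cycle_coordinates \<Gamma> B \<and> card B = b) \<and>
    coloring G \<Gamma> c \<and> unsplittable G \<Gamma> c \<and> traverses \<Gamma> es vs \<and> edges_outside \<Gamma> c H = set es \<and>
    connected_edges \<Gamma> (arcs \<Gamma> - set es)"

end

text \<open>
  As the color of \<open>e\<close> lies in \<open>H\<close>, this edge attaches the triangle to the complement of the circuit,
  wherever the other two edges at \<open>v\<close> belong.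
\<close>

locale special_model_truncation =
  colored_truncation G \<Gamma> v x y e f e' f' r c s + order_8_group_with_index_2_subgroup G H
  for G (structure) and \<Gamma> :: "('v, 'e) pre_digraph" and v x y e f e' f' r c s H +
  fixes es vs b
  assumes model: "special_model \<Gamma> c es vs b" and e_in_H: "c e \<in> H"
begin

lemma e_notin_es: "e \<notin> set es"
  using model e_in_H by (auto simp: special_model_def edges_outside_def)

text \<open>
  What the two kinds of truncation have in common: at most one side of the triangle, \<open>k\<close>, may
  become part of the circuit, so the complement of the circuit stays connected.
\<close>

lemma special_model_truncatedI:
  assumes "traverses truncated es' vs'"
    and es': "set es' = set es \<union> {a \<in> {e', f', r}. truncated_coloring a \<notin> H}"
    and k: "{e', f', r} - {k} \<subseteq> {a \<in> {e', f', r}. truncated_coloring a \<in> H}"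
  shows "special_model truncated truncated_coloring es' vs' (Suc b)"
proof -
  obtain B where B: "cycle_coordinates \<Gamma> B" "card B = b"
    using model by (auto simp: special_model_def)
  then have "finite B" "r \<notin> B"
    using new_arcs by (auto simp: cycle_coordinates_def)
  then have "cycle_coordinates truncated (insert r B)" "card (insert r B) = Suc b"
    using B cycle_coordinates_truncated by auto
  moreover have "connected_edges truncated
      ((arcs \<Gamma> - set es) \<union> {a \<in> {e', f', r}. truncated_coloring a \<in> H})"
    using model e_notin_es old k
    by (intro connected_truncated[where k = k]) (auto simp: special_model_def)
  moreover have "(arcs \<Gamma> - set es) \<union> {a \<in> {e', f', r}. truncated_coloring a \<in> H} =
      arcs truncated - set es'"
    using model new_arcs unfolding es' by (auto simp: special_model_def traverses_def)
  moreover have "edges_outside truncated truncated_coloring H = set es'"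
    using model by (simp add: es' edges_outside_truncated special_model_def)
  ultimately show ?thesis
    using model assms trivalent_truncated coloring_truncated unsplittable_truncated
    unfolding special_model_def by auto
qed

lemma special_model_truncated_off_circuit:
  assumes "c f \<in> H" "s \<in> H"
  shows "special_model truncated truncated_coloring es vs (Suc b)"
proof (rule special_model_truncatedI)
  have "f \<notin> set es"
    using model assms by (auto simp: special_model_def edges_outside_def)
  then show "traverses truncated es vs"
    using model e_notin_es by (intro traverses_truncated) (auto simp: special_model_def)
qed (use assms e_in_H mult_in in auto)

text \<open>
  As only \<open>c e\<close> lies in \<open>H\<close>, multiplying by \<open>s\<close> moves \<open>c e\<close> out of \<open>H\<close> and the other two colors at \<open>v\<close>
  into \<open>H\<close>. So \<open>f'\<close>, the side opposite to the end of \<open>e\<close>, is the only new edge on the circuit.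
\<close>

lemma special_model_truncated_on_circuit:
  assumes "c f \<notin> H" "s \<notin> H" "last es = f" "hd vs = v"
  shows "special_model truncated truncated_coloring (es @ [f']) (vs @ [y]) (Suc b)"
proof (rule special_model_truncatedI)
  show "traverses truncated (es @ [f']) (vs @ [y])"
    using model e_notin_es assms
    by (intro traverses_truncated_snoc) (auto simp: special_model_def)
  have out: "s \<otimes> c e \<notin> H" "c e \<otimes> c f \<notin> H"
    using assms s(1) e_in_H colors_at_corner(1,2) mult_in_iff[of s "c e"]
      mult_in_iff[of "c f" "c e"] by (simp_all add: m_comm)
  then have inside: "s \<otimes> c f \<in> H" "s \<otimes> (c e \<otimes> c f) \<in> H"
    using assms s(1) colors_at_corner(1,2) by (auto intro: mult_outside)
  then show "set (es @ [f']) = set es \<union> {a \<in> {e', f', r}. truncated_coloring a \<notin> H}"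
    using out distinct_names by auto
  show "{e', f', r} - {f'} \<subseteq> {a \<in> {e', f', r}. truncated_coloring a \<in> H}"
    using inside by auto
qed

end

lemma ex_truncation:
  fixes \<Gamma> :: "(nat, nat) pre_digraph"
  assumes "trivalent \<Gamma>" "corner \<Gamma> v e f"
  obtains x y e' f' r where "truncation \<Gamma> v x y e f e' f' r"
proof -
  interpret fin_digraph \<Gamma>
    using assms by (simp add: trivalent_def)
  have new: "\<exists>a. a \<notin> A" if "finite A" for A :: "nat set"
    using that by (intro ex_new_if_finite) auto
  obtain x where x: "x \<notin> verts \<Gamma>" using new[of "verts \<Gamma>"] by auto
  obtain y where y: "y \<notin> insert x (verts \<Gamma>)" using new[of "insert x (verts \<Gamma>)"] by auto
  obtain e' where e': "e' \<notin> arcs \<Gamma>" using new[of "arcs \<Gamma>"] by auto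
  obtain f' where f': "f' \<notin> insert e' (arcs \<Gamma>)"
    using new[of "insert e' (arcs \<Gamma>)"] by auto
  obtain r where "r \<notin> {e', f'} \<union> arcs \<Gamma>" using new[of "{e', f'} \<union> arcs \<Gamma>"] by auto
  with assms x y e' f' have "truncation \<Gamma> v x y e f e' f' r"
    by unfold_locales auto
  with that show thesis .
qed

context order_8_group_with_index_2_subgroup
begin

text \<open>
  The corner at \<open>w\<close>, where the circuit closes, is carried along: it is the place where the circuit
  is lengthened later on. It differs from \<open>v\<close>, since the edge \<open>last es\<close> of the circuit enters \<open>w\<close>,
  while both edges that enter \<open>v\<close> have their colors in \<open>H\<close>.
\<close>

lemma increase_betti:
  fixes \<Gamma> :: "(nat, nat) pre_digraph"
  assumes model: "special_model \<Gamma> c es vs b"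
    and vef: "corner \<Gamma> v e f" "c e \<in> H" "c f \<in> H"
    and wp: "corner \<Gamma> w p (last es)" "c p \<in> H"
  obtains \<Gamma>' :: "(nat, nat) pre_digraph" and c' e' f'
  where "special_model \<Gamma>' c' es vs (Suc b)" "corner \<Gamma>' v e' f'" "c' e' \<in> H" "c' f' \<in> H"
    "corner \<Gamma>' w p (last es)" "c' p \<in> H"
proof -
  have tri: "trivalent \<Gamma>" and col: "coloring G \<Gamma> c"
    and es: "es \<noteq> []" and outside: "set es = edges_outside \<Gamma> c H"
    using model by (auto simp: special_model_def traverses_def)
  obtain x y e' f' r where "truncation \<Gamma> v x y e f e' f' r"
    using ex_truncation[OF tri vef(1)] .
  then interpret truncation \<Gamma> v x y e f e' f' r .
  interpret colored_corner G \<Gamma> v x y e f e' f' r c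
    using col by unfold_locales
  have "\<one> \<noteq> c e \<otimes> c f"
    using colors_at_corner mult_eq_one_iff by metis
  moreover have "\<one> \<noteq> c e" "\<one> \<noteq> c f"
    using color old by metis+
  ultimately interpret special_model_truncation G \<Gamma> v x y e f e' f' r c \<one> H es vs b
    using model vef by unfold_locales simp_all
  have "last es \<in> edges_outside \<Gamma> c H"
    using es outside last_in_set by blast
  then have "last es \<notin> in_arcs \<Gamma> v"
    using vef in_arcs_v by (auto simp: edges_outside_def)
  then have "w \<noteq> v"
    using wp by (auto simp: corner_def)
  moreover have "p \<in> arcs \<Gamma>"
    using wp by (auto simp: corner_def in_arcs_def)
  ultimately have "corner truncated w p (last es)" "truncated_coloring p \<in> H"
    using wp other_corner by (auto simp: truncated_coloring_old)
  moreover have "truncated_coloring e' \<in> H" "truncated_coloring f' \<in> H"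
    using vef colors_at_corner by simp_all
  ultimately show thesis
    using special_model_truncated_off_circuit[OF vef(3) one_H] corner_truncated
    by (intro that)
qed

text \<open>
  Truncation at the vertex where the circuit closes. The complement of \<open>H\<close> has four elements, and
  two of them, the colors of the circuit at this vertex, are excluded for \<open>s\<close>.
\<close>

lemma increase_betti_and_length:
  fixes \<Gamma> :: "(nat, nat) pre_digraph"
  assumes model: "special_model \<Gamma> c es vs b"
    and circuit_corner: "corner \<Gamma> (hd vs) e (last es)" "c e \<in> H"
  obtains \<Gamma>' :: "(nat, nat) pre_digraph" and c' es' vs' e'
  where "special_model \<Gamma>' c' es' vs' (Suc b)" "length es' = Suc (length es)"
    "corner \<Gamma>' (hd vs') e' (last es')" "c' e' \<in> H"
proof -
  have tri: "trivalent \<Gamma>" and col: "coloring G \<Gamma> c"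
    and es: "es \<noteq> []" "vs \<noteq> []" and outside: "set es = edges_outside \<Gamma> c H"
    using model by (auto simp: special_model_def traverses_def)
  let ?f = "last es"
  have f: "c ?f \<notin> H"
    using es outside last_in_set by (fastforce simp: edges_outside_def)
  obtain x y e' f' r where "truncation \<Gamma> (hd vs) x y e ?f e' f' r"
    using ex_truncation[OF tri circuit_corner(1)] .
  then interpret truncation \<Gamma> "hd vs" x y e ?f e' f' r .
  interpret colored_corner G \<Gamma> "hd vs" x y e ?f e' f' r c
    using col by unfold_locales
  have "\<not> carrier G - H \<subseteq> {c ?f, c e \<otimes> c ?f}"
  proof
    assume "carrier G - H \<subseteq> {c ?f, c e \<otimes> c ?f}"
    then have "card (carrier G - H) \<le> card {c ?f, c e \<otimes> c ?f}"
      by (intro card_mono) auto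
    also have "\<dots> \<le> 2" by (simp add: card_insert_if)
    finally show False using card_outside by simp
  qed
  then obtain s where new_color: "s \<in> carrier G" "s \<notin> H" "s \<noteq> c ?f" "s \<noteq> c e \<otimes> c ?f"
    by blast
  then interpret special_model_truncation G \<Gamma> "hd vs" x y e ?f e' f' r c s H es vs b
    using model circuit_corner by unfold_locales auto
  have "special_model truncated truncated_coloring (es @ [f']) (vs @ [y]) (Suc b)"
    using f new_color by (intro special_model_truncated_on_circuit) auto
  moreover have "truncated_coloring e' \<in> H"
    unfolding truncated_coloring_simps
    using f new_color colors_at_corner by (intro mult_outside) auto
  moreover have "corner truncated (hd (vs @ [y])) e' (last (es @ [f']))"
    using corner_truncated es by simp
  ultimately show thesis
    by (intro that[of truncated truncated_coloring "es @ [f']" "vs @ [y]" e']) simp_all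
qed

end

section \<open>The tetrahedron\<close>

text \<open>
  Vertex 0 is the center of the star formed by the edges 0, 1, 2, and the edges 3, 4, 5 form the
  opposite triangle. The orientation makes two edges enter each of the vertices 0 and 1, the places
  for the two kinds of truncation.
\<close>

definition tetrahedron :: "(nat, nat) pre_digraph" where
  "tetrahedron = \<lparr>verts = {0, 1, 2, 3}, arcs = {0, 1, 2, 3, 4, 5},
    tail = (!) [2, 3, 0, 3, 1, 2], head = (!) [0, 0, 1, 1, 2, 3]\<rparr>"

lemma tetrahedron_simps [simp]:
  "verts tetrahedron = {0, 1, 2, 3}" "arcs tetrahedron = {0, 1, 2, 3, 4, 5}"
  "tail tetrahedron = (!) [2, 3, 0, 3, 1, 2]" "head tetrahedron = (!) [0, 0, 1, 1, 2, 3]"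
  by (simp_all add: tetrahedron_def)

lemma nth_6 [simp]:
  "[a0, a1, a2, a3, a4, a5] ! 2 = a2" "[a0, a1, a2, a3, a4, a5] ! 3 = a3"
  "[a0, a1, a2, a3, a4, a5] ! 4 = a4" "[a0, a1, a2, a3, a4, a5] ! 5 = a5"
  by (simp_all add: eval_nat_numeral)

lemma tetrahedron_arcs_at:
  "in_arcs tetrahedron 0 = {0, 1}" "out_arcs tetrahedron 0 = {2}"
  "in_arcs tetrahedron 1 = {2, 3}" "out_arcs tetrahedron 1 = {4}"
  "in_arcs tetrahedron 2 = {4}" "out_arcs tetrahedron 2 = {0, 5}"
  "in_arcs tetrahedron 3 = {5}" "out_arcs tetrahedron 3 = {1, 3}"
  by (auto simp: in_arcs_def out_arcs_def)

lemma trivalent_tetrahedron: "trivalent tetrahedron"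
proof -
  have "fin_digraph tetrahedron"
    by unfold_locales auto
  then show ?thesis
    using tetrahedron_arcs_at[unfolded One_nat_def]
    by (auto simp: trivalent_def tetrahedron_arcs_at)
qed

lemma cycle_coordinates_tetrahedron: "cycle_coordinates tetrahedron {0, 1, 3}"
proof -
  have Z: "f \<in> cycle_space tetrahedron \<longleftrightarrow> (\<forall>a. a \<notin> {0, 1, 2, 3, 4, 5} \<longrightarrow> f a = 0) \<and>
      f 2 = f 0 + f 1 \<and> f 4 = f 2 + f 3 \<and> f 5 = f 1 + f 3" for f
    using tetrahedron_arcs_at[unfolded One_nat_def]
    by (auto simp: cycle_space_def boundary_def tetrahedron_arcs_at)
  have "f = 0" if "f \<in> cycle_space tetrahedron" "f 0 = 0" "f 1 = 0" "f 3 = 0" for f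
  proof
    fix a show "f a = 0 a"
      using that unfolding Z by (cases "a \<in> {0, 1, 2, 3, 4, 5}") auto
  qed
  moreover have "\<exists>f\<in>cycle_space tetrahedron. f 0 = i \<and> f 1 = j \<and> f 3 = k" for i j k
    by (rule bexI[of _ "(\<lambda>_. 0)(0 := i, 1 := j, 2 := i + j, 3 := k, 4 := i + j + k, 5 := j + k)"])
      (auto simp: Z)
  ultimately show ?thesis
    by (auto simp: cycle_coordinates_def)
qed

text \<open>
  The two cases are the star of vertex 0, as the complement of the special circuit, and the
  deletion of at most one edge, as all colors will be distinct.
\<close>

lemma connected_edges_tetrahedron:
  assumes F: "F \<subseteq> {0, 1, 2, 3, 4, 5}"
    and large: "{0, 1, 2} \<subseteq> F \<or> {0, 1, 2, 3, 4, 5} - {k} \<subseteq> F"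
  shows "connected_edges tetrahedron F"
proof (rule connected_edgesI)
  let ?L = "linked tetrahedron F"
  show "F \<noteq> {}" using large by auto
  have star: "0 \<in> F \<Longrightarrow> ?L 0 2" "1 \<in> F \<Longrightarrow> ?L 0 3" "2 \<in> F \<Longrightarrow> ?L 0 1"
    and rim: "3 \<in> F \<Longrightarrow> ?L 3 1" "5 \<in> F \<Longrightarrow> ?L 2 3" "5 \<in> F \<Longrightarrow> ?L 3 2"
    using linked_edge[of _ F tetrahedron] by fastforce+
  have "{0, 1, 2} \<subseteq> F \<or> {1, 2, 5} \<subseteq> F \<or> {0, 2, 5} \<subseteq> F \<or> {0, 1, 3} \<subseteq> F"
  proof (cases "{0, 1, 2} \<subseteq> F")
    case False
    then have "a = k \<or> a \<in> F" if "a \<in> {0, 1, 2, 3, 4, 5}" for a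
      using large that by blast
    from this[of 0] this[of 1] this[of 2] this[of 3] this[of 5] show ?thesis
      by simp (elim disjE; simp)
  qed simp
  then have "?L 0 1 \<and> ?L 0 2 \<and> ?L 0 3"
    using star rim linked_trans[of tetrahedron F 0 2 3] linked_trans[of tetrahedron F 0 3 2]
      linked_trans[of tetrahedron F 0 3 1] by (elim disjE; simp)
  then show "?L 0 (tail tetrahedron a)" if "a \<in> F" for a
    using that F by auto
qed

context order_8_group_with_index_2_subgroup
begin

text \<open>
  The star is colored by the nontrivial elements \<open>q\<close>, \<open>r\<close>, \<open>q \<otimes> r\<close> of \<open>H\<close>. Once one edge of the
  triangle has a color \<open>t\<close> outside \<open>H\<close>, the colors of its other two edges are forced; they lie in the
  same coset, so all six colors are distinct.
\<close>

lemma ex_tetrahedron_coloring: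
  obtains c where "special_model tetrahedron c [4, 5, 3] [1, 2, 3] 3" "c 0 \<in> H" "c 1 \<in> H" "c 2 \<in> H"
proof -
  have "card (H - {\<one>}) = 3"
    using card_H one_H by simp
  then obtain q r u where "H - {\<one>} = {q, r, u}" "q \<noteq> r"
    by (auto simp: card_3_iff)
  then have qr: "q \<in> H" "r \<in> H" "q \<noteq> \<one>" "r \<noteq> \<one>" "q \<noteq> r" by auto
  obtain t where t: "t \<in> carrier G" "t \<notin> H"
    using card_outside by (metis Diff_iff card.empty ex_in_conv zero_neq_numeral)
  have [simp]: "q \<in> carrier G" "r \<in> carrier G" "t \<in> carrier G"
    using qr t H_subset by auto
  define c where "c = (!) [q, r, q \<otimes> r, t, t \<otimes> (q \<otimes> r), t \<otimes> r]"
  have c: "c 0 = q" "c 1 = r" "c (Suc 0) = r" "c 2 = q \<otimes> r" "c 3 = t" "c 4 = t \<otimes> (q \<otimes> r)" "c 5 = t \<otimes> r"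
    by (simp_all add: c_def)
  have in_H: "c 0 \<in> H" "c 1 \<in> H" "c 2 \<in> H" and out_H: "c 3 \<notin> H" "c 4 \<notin> H" "c 5 \<notin> H"
    using qr t by (auto simp: c mult_in mult_in_iff)
  have closed: "c a \<in> carrier G" if "a \<in> {0, 1, 2, 3, 4, 5}" for a
    using that by (auto simp: c)
  have qr': "q \<otimes> r \<noteq> \<one>" "q \<otimes> r \<noteq> q" "q \<otimes> r \<noteq> r"
    using qr by (simp_all add: mult_eq_one_iff)
  have inj: "inj_on c {0, 1, 2, 3, 4, 5}"
  proof -
    have "c a \<noteq> c b" if "a \<in> {0, 1, 2}" "b \<in> {3, 4, 5}" for a b
      using that in_H out_H by auto
    moreover have "inj_on c {0, 1, 2}" "inj_on c {3, 4, 5}"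
      using qr qr' by (auto simp: c)
    moreover have "{0, 1, 2, 3, 4, 5::nat} = {0, 1, 2} \<union> {3, 4, 5}" by auto
    ultimately show ?thesis
      by (simp only: inj_on_Un) blast
  qed
  have "coloring G tetrahedron c"
    unfolding coloring_def
  proof (intro conjI)
    have "c a \<noteq> \<one>" if "a \<in> {0, 1, 2, 3, 4, 5}" for a
      using that qr qr' out_H one_H by (auto simp: c)
    then show "\<forall>a\<in>arcs tetrahedron. c a \<in> carrier G - {\<one>}"
      using closed by simp
    have "u = 0 \<or> u = 1 \<or> u = 2 \<or> u = 3 \<Longrightarrow> finprod G c (in_arcs tetrahedron u) \<otimes>
        finprod G c (out_arcs tetrahedron u) = \<one>" for u
      by (elim disjE; simp only: tetrahedron_arcs_at; simp add: c m_ac square square_cancel)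
    then show "\<forall>u\<in>verts tetrahedron. finprod G c (in_arcs tetrahedron u) \<otimes>
        finprod G c (out_arcs tetrahedron u) = \<one>"
      by simp
    have "{q, r, t} \<subseteq> c ` arcs tetrahedron"
      using c by auto
    moreover have "c ` arcs tetrahedron \<subseteq> carrier G"
      using closed unfolding tetrahedron_simps by blast
    ultimately show "generate G (c ` arcs tetrahedron) = carrier G"
      by (rule generate_eq_carrier[OF _ _ qr]) (simp add: t)
  qed
  moreover have "unsplittable G tetrahedron c"
    unfolding unsplittable_def
  proof
    fix g
    have "\<exists>k. A - {k} \<subseteq> {a \<in> A. c a \<noteq> g}" if "inj_on c A" for A
      using that by (cases "\<exists>k\<in>A. c k = g") (auto simp: inj_on_def)
    from this[OF inj] obtain k
      where "{0, 1, 2, 3, 4, 5} - {k} \<subseteq> {a \<in> {0, 1, 2, 3, 4, 5}. c a \<noteq> g}" ..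
    then show "connected_edges tetrahedron {a \<in> arcs tetrahedron. c a \<noteq> g}"
      unfolding tetrahedron_simps by (intro connected_edges_tetrahedron disjI2 Collect_restrict)
  qed
  moreover have "edges_outside tetrahedron c H = set [4, 5, 3]"
    using in_H out_H by (auto simp: edges_outside_def)
  moreover have "traverses tetrahedron [4, 5, 3] [1, 2, 3]"
  proof -
    have "{tail tetrahedron ([4, 5, 3] ! i), head tetrahedron ([4, 5, 3] ! i)} =
        {[1, 2, 3] ! i, [1, 2, 3] ! (Suc i mod 3)}" if "i < 3" for i
    proof -
      consider "i = 0" | "i = 1" | "i = 2" using \<open>i < 3\<close> by linarith
      then show ?thesis
        by cases (simp_all add: insert_commute mod_Suc)
    qed
    then show ?thesis by (simp add: traverses_def)
  qed
  moreover have "connected_edges tetrahedron (arcs tetrahedron - set [4, 5, 3])"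
    by (intro connected_edges_tetrahedron) auto
  moreover have "\<exists>B. cycle_coordinates tetrahedron B \<and> card B = 3"
    using cycle_coordinates_tetrahedron by (intro exI[of _ "{0, 1, 3}"]) simp
  ultimately have "special_model tetrahedron c [4, 5, 3] [1, 2, 3] 3"
    unfolding special_model_def using trivalent_tetrahedron by blast
  with in_H that show thesis by blast
qed

lemma ex_special_model_triangle:
  "\<exists>(\<Gamma> :: (nat, nat) pre_digraph) c es vs v e f p. special_model \<Gamma> c es vs (3 + j) \<and>
    length es = 3 \<and> corner \<Gamma> v e f \<and> c e \<in> H \<and> c f \<in> H \<and>
    corner \<Gamma> (hd vs) p (last es) \<and> c p \<in> H"
proof (induction j)
  case 0
  obtain c where "special_model tetrahedron c [4, 5, 3] [1, 2, 3] 3"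
    "c 0 \<in> H" "c 1 \<in> H" "c 2 \<in> H"
    by (rule ex_tetrahedron_coloring)
  moreover have "corner tetrahedron 0 0 1" "corner tetrahedron (hd [1, 2, 3]) 2 (last [4, 5, 3])"
    using tetrahedron_arcs_at by (simp_all add: corner_def)
  moreover have "length [4::nat, 5, 3] = 3" by simp
  ultimately show ?case
    unfolding add_0_right by blast
next
  case (Suc j)
  then obtain \<Gamma> :: "(nat, nat) pre_digraph" and c es vs v e f p
    where model: "special_model \<Gamma> c es vs (3 + j)" "corner \<Gamma> v e f" "c e \<in> H" "c f \<in> H"
      "corner \<Gamma> (hd vs) p (last es)" "c p \<in> H" and len: "length es = 3"
    by blast
  from increase_betti[OF model] len show ?case
    unfolding add_Suc_right by metis
qed

lemma ex_special_model:
  "\<exists>(\<Gamma> :: (nat, nat) pre_digraph) c es vs p. special_model \<Gamma> c es vs (3 + j + i) \<and>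
    length es = 3 + i \<and> corner \<Gamma> (hd vs) p (last es) \<and> c p \<in> H"
proof (induction i)
  case 0
  then show ?case
    using ex_special_model_triangle[of j] unfolding add_0_right by blast
next
  case (Suc i)
  then obtain \<Gamma> :: "(nat, nat) pre_digraph" and c es vs p
    where model: "special_model \<Gamma> c es vs (3 + j + i)" "corner \<Gamma> (hd vs) p (last es)" "c p \<in> H"
      and len: "length es = 3 + i"
    by blast
  from increase_betti_and_length[OF model] len show ?case
    unfolding add_Suc_right by metis
qed

end

section \<open>Existence for all circuit lengths up to the first Betti number\<close>

theorem proposition1p3:
  fixes m b :: nat and G :: "('g, 'x) monoid_scheme"
  assumes "3 \<le> m" and "m \<le> b"
    and "group G"
    and "G \<cong> integer_mod_group 2 \<times>\<times> (integer_mod_group 2 \<times>\<times> integer_mod_group 2)"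
  shows "\<exists>(\<Gamma> :: (nat, nat) pre_digraph) (c :: nat \<Rightarrow> 'g).
    trivalent \<Gamma> \<and> first_betti \<Gamma> = b \<and>
    coloring G \<Gamma> c \<and> unsplittable G \<Gamma> c \<and>
    (\<exists>C. m_circuit \<Gamma> m C \<and> special G \<Gamma> c C)"
proof -
  interpret group G by fact
  let ?Z2 = "integer_mod_group 2"
  let ?K = "?Z2 \<times>\<times> (?Z2 \<times>\<times> ?Z2)"
  have K: "group ?K" by (intro DirProd_group) simp_all
  obtain \<phi> where \<phi>: "\<phi> \<in> hom G ?K" "bij_betw \<phi> (carrier G) (carrier ?K)"
    using assms(4) by (auto simp: is_iso_def iso_def)
  have carrier_K: "carrier ?K = {0..<2} \<times> {0..<2} \<times> {0..<2}"
    by (simp add: carrier_integer_mod_group)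
  have mult_K: "k \<otimes>\<^bsub>?K\<^esub> l = ((fst k + fst l) mod 2, (fst (snd k) + fst (snd l)) mod 2,
      (snd (snd k) + snd (snd l)) mod 2)" for k l
    by (cases k, cases l) auto
  \<comment> \<open>Any subgroup of order 4 would do; this one is the kernel of the first coordinate.\<close>
  define H where "H = {a \<in> carrier G. fst (\<phi> a) = 0}"
  have one: "\<phi> \<one>\<^bsub>G\<^esub> = (0, 0, 0)"
    using hom_one[OF \<phi>(1) \<open>group G\<close> K] by simp
  have closed: "\<phi> a \<in> {0..<2} \<times> {0..<2} \<times> {0..<2}" if "a \<in> carrier G" for a
    using that \<phi>(2) carrier_K by (metis bij_betwE)
  have "a \<otimes>\<^bsub>G\<^esub> a = \<one>\<^bsub>G\<^esub>" if a: "a \<in> carrier G" for a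
  proof -
    have "\<phi> (a \<otimes>\<^bsub>G\<^esub> a) = \<phi> \<one>\<^bsub>G\<^esub>"
      using hom_mult[OF \<phi>(1) a a] one by (simp add: mult_K)
    then show ?thesis
      using \<phi>(2) a by (auto simp: bij_betw_def inj_on_def)
  qed
  then interpret elementary_abelian_2_group G by unfold_locales
  have "subgroup H G"
    by (rule subgroupI) (auto simp: H_def inv_self hom_mult[OF \<phi>(1)] mult_K one intro!: exI[of _ "\<one>\<^bsub>G\<^esub>"])
  moreover have "order G = 8"
    using bij_betw_same_card[OF \<phi>(2)] unfolding order_def carrier_K by simp
  moreover have "card H = 4"
  proof -
    have "\<phi> ` H = {0} \<times> {0..<2} \<times> {0..<2}"
    proof
      show "\<phi> ` H \<subseteq> {0} \<times> {0..<2} \<times> {0..<2}"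
        using closed by (fastforce simp: H_def)
      show "{0} \<times> {0..<2} \<times> {0..<2} \<subseteq> \<phi> ` H"
      proof
        fix k :: "int \<times> int \<times> int" assume k: "k \<in> {0} \<times> {0..<2} \<times> {0..<2}"
        then have "k \<in> \<phi> ` carrier G"
          unfolding bij_betw_imp_surj_on[OF \<phi>(2)] carrier_K by auto
        then obtain a where a: "a \<in> carrier G" "k = \<phi> a" by blast
        moreover have "a \<in> H" using a k by (auto simp: H_def)
        ultimately show "k \<in> \<phi> ` H" by blast
      qed
    qed
    then have "bij_betw \<phi> H ({0} \<times> {0..<2} \<times> {0..<2})"
      using \<phi>(2) by (auto simp: bij_betw_def H_def intro: inj_on_subset)
    then show ?thesis by (simp add: bij_betw_same_card)
  qed
  ultimately interpret order_8_group_with_index_2_subgroup G H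
    by (intro order_8_group_with_index_2_subgroup.intro elementary_abelian_2_group_axioms
        order_8_group_with_index_2_subgroup_axioms.intro)
  have "3 + (b - m) + (m - 3) = b" "3 + (m - 3) = m" using assms(1,2) by auto
  then obtain \<Gamma> :: "(nat, nat) pre_digraph" and c es vs
    where model: "special_model \<Gamma> c es vs b" and len: "length es = m"
    using ex_special_model[of "b - m" "m - 3"] by metis
  have "m_circuit \<Gamma> m (set es)"
    using model len m_circuit_if_traverses by (auto simp: special_model_def)
  moreover have "special G \<Gamma> c (set es)"
    using model index2 unfolding special_def special_model_def by metis
  moreover have "first_betti \<Gamma> = b"
    using model first_betti_eq_card by (auto simp: special_model_def)
  ultimately show ?thesis
    using model unfolding special_model_def by blast
qed

end
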